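(* Let $\lambda/\mu$ be a connected skew shape with Lascoux–Pragacz decomposition $(\theta_1,\dots,\theta_k)$. An SSYT $T$ of shape $\lambda/\mu$ lies in $\mathrm{SSYT}_{\min}(\lambda/\mu)$ if and only if (i) for every $r$ and every cell $(i,j)$ of $\theta_r$, $T(i,j)\le ht_{\theta_r}(i)$; and (ii) whenever $(i,j)$ and $(i+1,j)$ both belong to the same strip $\theta_r$, $T(i+1,j)-T(i,j)=1$.
   Context: $[\lambda]=\{(i,j):1\le i\le\ell(\lambda),1\le j\le\lambda_i\}$ (English convention), $\lambda'$ conjugate, $[\lambda/\mu]=[\lambda]\setminus[\mu]$, assumed connected. An SSYT of shape $\lambda/\mu$ is a filling of $[\lambda/\mu]$ by nonnegative integers weakly increasing in rows and strictly increasing down columns. Lascoux–Pragacz decomposition: a border strip is a connected skew shape with no $2\times2$ square. For $\varepsilon\ge0$ let $L_\varepsilon=\{(i,j)\in[\lambda/\mu]:(i+\varepsilon,j+\varepsilon)\in[\lambda/\mu],(i+\varepsilon+1,j+\varepsilon+1)\notin[\lambda]\}$; the connected components of all the $L_\varepsilon$, listed in decreasing order of the content $j-i$ of their north-east-most cell, are $\theta_1,\dots,\theta_k$. $\mathsf f(\theta_r)$ is the row of the NE-most cell of $\theta_r$ and $ht_{\theta_r}(i)=i-\mathsf f(\theta_r)$; $\theta_r(j)$ is the set of cells of $\theta_r$ in column $j$. Minimal SSYT: $T_0(i,j)=i-\mu'_j-1$. For an SSYT $T$, a nonempty $\theta_k(j)$ with top cell $(i,j)$ and bottom cell $(i',j)$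 is active if (a) $T(i,j)<ht_{\theta_k}(i)$ and (b) $T(i,j)<T(i,j+1)$ and $T(i',j)<T(i'+1,j)-1$ (each imposed when the relevant cell lies in $[\lambda/\mu]$). The move $\delta_{(k;j)}$ adds $1$ to every entry of an active $\theta_k(j)$. $\mathrm{SSYT}_{\min}(\lambda/\mu)$ is the set of tableaux obtained from $T_0$ by finite sequences of such moves. *)

theory Defs
  imports Main "HOL-Library.FuncSet"
begin

type_synonym cell = "nat \<times> nat"

definition is_partition :: "nat list \<Rightarrow> bool" where
  "is_partition l \<longleftrightarrow> sorted_wrt (\<ge>) l \<and> (\<forall>x\<in>set l. 0 < x)"

text \<open>Parts, rows and columns are numbered from 1; parts beyond the length are 0.\<close>

definition part :: "nat list \<Rightarrow> nat \<Rightarrow> nat" where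
  "part l i = (if 1 \<le> i \<and> i \<le> length l then l ! (i - 1) else 0)"

definition diagram :: "nat list \<Rightarrow> cell set" where
  "diagram l = {(i, j). 1 \<le> i \<and> i \<le> length l \<and> 1 \<le> j \<and> j \<le> part l i}"

definition conj_part :: "nat list \<Rightarrow> nat \<Rightarrow> nat" where
  "conj_part l j = card {i. (i, j) \<in> diagram l}"

definition skew_shape :: "nat list \<Rightarrow> nat list \<Rightarrow> bool" where
  "skew_shape lam mu \<longleftrightarrow> is_partition lam \<and> is_partition mu \<and> diagram mu \<subseteq> diagram lam"

definition skew :: "nat list \<Rightarrow> nat list \<Rightarrow> cell set" where
  "skew lam mu = diagram lam - diagram mu"

definition adj_on :: "cell set \<Rightarrow> (cell \<times> cell) set" where
  "adj_on S = {((i, j), (i', j')). (i, j) \<in> S \<and> (i', j') \<in> S \<and>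
     \<bar>int i - int i'\<bar> + \<bar>int j - int j'\<bar> = 1}"

definition connected_cells :: "cell set \<Rightarrow> bool" where
  "connected_cells S \<longleftrightarrow> (\<forall>c\<in>S. \<forall>d\<in>S. (c, d) \<in> (adj_on S)\<^sup>*)"

definition cell_components :: "cell set \<Rightarrow> cell set set" where
  "cell_components S = S // (adj_on S)\<^sup>*"

definition SSYT :: "nat list \<Rightarrow> nat list \<Rightarrow> (cell \<Rightarrow> int) set" where
  "SSYT lam mu = {T \<in> extensional (skew lam mu).
     (\<forall>c\<in>skew lam mu. 0 \<le> T c) \<and>
     (\<forall>i j j'. (i, j) \<in> skew lam mu \<and> (i, j') \<in> skew lam mu \<and> j < j' \<longrightarrow> T (i, j) \<le> T (i, j')) \<and>
     (\<forall>i i' j. (i, j) \<in> skew lam mu \<and> (i', j) \<in> skew lam mu \<and> i < i' \<longrightarrow> T (i, j) < T (i', j))}"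

definition LP_layer :: "nat list \<Rightarrow> nat list \<Rightarrow> nat \<Rightarrow> cell set" where
  "LP_layer lam mu e = {(i, j) \<in> skew lam mu.
     (i + e, j + e) \<in> skew lam mu \<and> (i + e + 1, j + e + 1) \<notin> diagram lam}"

definition LP_strips :: "nat list \<Rightarrow> nat list \<Rightarrow> cell set set" where
  "LP_strips lam mu = (\<Union>e. cell_components (LP_layer lam mu e))"

definition content :: "cell \<Rightarrow> int" where
  "content c = int (snd c) - int (fst c)"

text \<open>The cell weakly north and weakly east of all others. It exists for every strip, since no
  cell of a layer lies strictly south-east of another cell of the same layer.\<close>

definition NE_cell :: "cell set \<Rightarrow> cell" where
  "NE_cell \<theta> = (THE c. c \<in> \<theta> \<and> (\<forall>d\<in>\<theta>. fst c \<le> fst d \<and> snd d \<le> snd c))"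

definition LP_decomposition :: "nat list \<Rightarrow> nat list \<Rightarrow> cell set list \<Rightarrow> bool" where
  "LP_decomposition lam mu \<theta>s \<longleftrightarrow> distinct \<theta>s \<and> set \<theta>s = LP_strips lam mu \<and>
     sorted_wrt (\<lambda>\<theta> \<theta>'. content (NE_cell \<theta>) \<ge> content (NE_cell \<theta>')) \<theta>s"

definition first_row :: "cell set \<Rightarrow> nat" where
  "first_row \<theta> = fst (NE_cell \<theta>)"

definition ht :: "cell set \<Rightarrow> nat \<Rightarrow> int" where
  "ht \<theta> i = int i - int (first_row \<theta>)"

definition strip_col :: "cell set \<Rightarrow> nat \<Rightarrow> cell set" where
  "strip_col \<theta> j = {c \<in> \<theta>. snd c = j}"

definition T0 :: "nat list \<Rightarrow> nat list \<Rightarrow> cell \<Rightarrow> int" where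
  "T0 lam mu = restrict (\<lambda>(i, j). int i - int (conj_part mu j) - 1) (skew lam mu)"

definition active :: "nat list \<Rightarrow> nat list \<Rightarrow> (cell \<Rightarrow> int) \<Rightarrow> cell set \<Rightarrow> nat \<Rightarrow> bool" where
  "active lam mu T \<theta> j \<longleftrightarrow> T \<in> SSYT lam mu \<and> strip_col \<theta> j \<noteq> {} \<and>
     (let i = Min (fst ` strip_col \<theta> j); i' = Max (fst ` strip_col \<theta> j) in
        T (i, j) < ht \<theta> i \<and>
        ((i, j + 1) \<in> skew lam mu \<longrightarrow> T (i, j) < T (i, j + 1)) \<and>
        ((i' + 1, j) \<in> skew lam mu \<longrightarrow> T (i', j) < T (i' + 1, j) - 1))"

definition move :: "cell set \<Rightarrow> nat \<Rightarrow> (cell \<Rightarrow> int) \<Rightarrow> cell \<Rightarrow> int" where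
  "move \<theta> j T = (\<lambda>c. if c \<in> strip_col \<theta> j then T c + 1 else T c)"

inductive_set SSYT_min :: "nat list \<Rightarrow> nat list \<Rightarrow> (cell \<Rightarrow> int) set"
  for lam mu :: "nat list" where
  base: "T0 lam mu \<in> SSYT_min lam mu"
| step: "\<lbrakk>T \<in> SSYT_min lam mu; \<theta> \<in> LP_strips lam mu; active lam mu T \<theta> j\<rbrakk>
    \<Longrightarrow> move \<theta> j T \<in> SSYT_min lam mu"

end

theory Submission
  imports Defs
begin

text \<open>Both conditions hold for the minimal tableau and survive every move: the north-east end
  of a strip meeting column \<open>j\<close> lies weakly above the top cell of that column of the
  skew shape, and a move shifts a whole strip column. Conversely, let \<open>T\<close> satisfy the
  conditions and differ from the minimal tableau, which it dominates. In the leftmost column where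
  they differ take the topmost differing cell. By (ii) it is the top of its strip column, and that
  strip column can be decreased by 1: everything to its left and above it is still minimal. The
  move undoing this is active, so induction on the sum of the entries applies.\<close>

section \<open>Diagrams\<close>

lemma diagram_downward_closed:
  assumes "is_partition l" "(i', j') \<in> diagram l" "1 \<le> i" "i \<le> i'" "1 \<le> j" "j \<le> j'"
  shows "(i, j) \<in> diagram l"
proof -
  have s: "sorted_wrt (\<ge>) l" using assms(1) by (simp add: is_partition_def)
  have i': "1 \<le> i'" "i' \<le> length l" "j' \<le> l ! (i' - 1)"
    using assms(2) by (auto simp: diagram_def part_def)
  have "l ! (i' - 1) \<le> l ! (i - 1)"
  proof (cases "i = i'")
    case False
    then have "i - 1 < i' - 1" "i' - 1 < length l" using assms i' by auto
    then show ?thesis using sorted_wrt_nth_less[OF s] by blast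
  qed simp
  then show ?thesis using assms i' by (auto simp: diagram_def part_def)
qed

lemma finite_diagram: "finite (diagram l)"
proof (rule finite_subset)
  show "diagram l \<subseteq> (SIGMA i:{..length l}. {..part l i})" by (auto simp: diagram_def)
qed auto

text \<open>A column of the diagram is closed under decreasing the row, hence it is the interval
  from 1 to its maximum, and that maximum is its cardinality.\<close>

lemma diagram_conj_part:
  assumes "is_partition l" "1 \<le> j"
  shows "(i, j) \<in> diagram l \<longleftrightarrow> 1 \<le> i \<and> i \<le> conj_part l j"
proof -
  define A where "A = {i. (i, j) \<in> diagram l}"
  have fin: "finite A"
    by (rule finite_subset[of _ "fst ` diagram l"]) (force simp: A_def finite_diagram)+
  have "A = {1..card A}"
  proof (cases "A = {}")
    case False
    have A: "A = {1..Max A}"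
    proof
      show "A \<subseteq> {1..Max A}" using fin by (auto simp: A_def diagram_def)
      have max: "(Max A, j) \<in> diagram l" using Max_in[OF fin False] unfolding A_def by blast
      show "{1..Max A} \<subseteq> A"
      proof
        fix x assume "x \<in> {1..Max A}"
        then have "(x, j) \<in> diagram l"
          using diagram_downward_closed[OF assms(1) max] assms(2) by simp
        then show "x \<in> A" by (simp add: A_def)
      qed
    qed
    have "card {1..Max A} = Max A" by simp
    with A show ?thesis by metis
  qed simp
  then have "i \<in> A \<longleftrightarrow> i \<in> {1..card A}" by (rule arg_cong)
  then show ?thesis by (simp add: A_def conj_part_def)
qed

lemma conj_part_antimono:
  assumes "is_partition l" "1 \<le> j" "j \<le> j'"
  shows "conj_part l j' \<le> conj_part l j"
proof (cases "conj_part l j' = 0")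
  case False
  then have "(conj_part l j', j') \<in> diagram l"
    using diagram_conj_part[of l j'] assms by simp
  then have "(conj_part l j', j) \<in> diagram l"
    using diagram_downward_closed[OF assms(1)] assms False by simp
  then show ?thesis using diagram_conj_part[of l j] assms by simp
qed simp

text \<open>Membership in \<open>lam\<close> passes down from the south-east corner, and avoidance
  of \<open>mu\<close> from the north-west one.\<close>

lemma skew_convex:
  assumes "skew_shape lam mu" "(i, j) \<in> skew lam mu" "(i', j') \<in> diagram lam"
    "i \<le> a" "a \<le> i'" "j \<le> b" "b \<le> j'"
  shows "(a, b) \<in> skew lam mu"
proof -
  have p: "is_partition lam" "is_partition mu" using assms(1) by (auto simp: skew_shape_def)
  have ij: "1 \<le> i" "1 \<le> j" "(i, j) \<notin> diagram mu" using assms(2) by (auto simp: skew_def diagram_def)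
  have "(a, b) \<in> diagram lam" using diagram_downward_closed[OF p(1) assms(3)] assms ij by simp
  moreover have "(a, b) \<notin> diagram mu"
    using diagram_downward_closed[OF p(2), of a b i j] assms ij by blast
  ultimately show ?thesis by (simp add: skew_def)
qed

lemma skew_pos: "(i, j) \<in> skew lam mu \<Longrightarrow> 1 \<le> i \<and> 1 \<le> j"
  by (auto simp: skew_def diagram_def)

lemma finite_skew: "finite (skew lam mu)"
  by (simp add: skew_def finite_diagram)

section \<open>Strips\<close>

text \<open>Take the largest diagonal shift that stays in \<open>lam\<close>; shifts are bounded
  because rows are, and convexity puts the shifted cell in the skew shape.\<close>

lemma skew_cell_in_layer:
  assumes "skew_shape lam mu" "(i, j) \<in> skew lam mu"
  shows "\<exists>e. (i, j) \<in> LP_layer lam mu e"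
proof -
  let ?P = "\<lambda>e. (i + e, j + e) \<in> diagram lam"
  have P0: "?P 0" using assms(2) by (simp add: skew_def)
  have bound: "e \<le> length lam" if "?P e" for e using that by (auto simp: diagram_def)
  obtain e where e: "?P e" "\<And>e'. ?P e' \<Longrightarrow> e' \<le> e"
    using ex_has_greatest_nat[of ?P 0 "\<lambda>e. e" "Suc (length lam)"] P0 bound
    by (auto simp: less_Suc_eq_le)
  have "(i + e, j + e) \<in> skew lam mu" using skew_convex[OF assms e(1)] by simp
  moreover have "\<not> ?P (e + 1)" using e(2)[of "e + 1"] by auto
  ultimately show ?thesis using assms(2) by (auto simp: LP_layer_def)
qed

text \<open>With two indices \<open>e < e'\<close>, the shift by \<open>e + 1\<close> lies between
  the cell and its shift by \<open>e'\<close>, so it could not leave \<open>lam\<close>.\<close>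

lemma layer_unique:
  assumes "skew_shape lam mu" "c \<in> LP_layer lam mu e" "c \<in> LP_layer lam mu e'"
  shows "e = e'"
proof -
  have "\<not> e < e'" if "c \<in> LP_layer lam mu e" "c \<in> LP_layer lam mu e'" for e e'
  proof
    assume "e < e'"
    obtain i j where c: "c = (i, j)" by force
    have "(i, j) \<in> skew lam mu" "(i + e', j + e') \<in> diagram lam"
      using that c by (auto simp: LP_layer_def skew_def)
    then have "(i + e + 1, j + e + 1) \<in> skew lam mu"
      using skew_convex[OF assms(1)] \<open>e < e'\<close> by simp
    then show False using that(1) c by (simp add: LP_layer_def skew_def)
  qed
  then show ?thesis using assms by (meson linorder_neqE_nat)
qed

text \<open>If the second cell were strictly south-east, its shift by \<open>e\<close> would be
  weakly south-east of the first cell's shift by \<open>e + 1\<close> and force the latter into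
  \<open>lam\<close>.\<close>

lemma layer_no_strict_SE:
  assumes "skew_shape lam mu" "(i, j) \<in> LP_layer lam mu e" "(i', j') \<in> LP_layer lam mu e" "i < i'"
  shows "j' \<le> j"
proof (rule ccontr)
  assume "\<not> j' \<le> j"
  have "(i, j) \<in> skew lam mu" "(i' + e, j' + e) \<in> diagram lam"
    using assms by (auto simp: LP_layer_def skew_def)
  then have "(i + e + 1, j + e + 1) \<in> skew lam mu"
    using skew_convex[OF assms(1)] assms(4) \<open>\<not> j' \<le> j\<close> by simp
  then show False using assms(2) by (simp add: LP_layer_def skew_def)
qed

section \<open>Strips as connected components of layers\<close>

lemma sym_adj_on: "sym (adj_on S)"
  by (auto simp: sym_def adj_on_def)

lemma adj_on_rtrancl_mem: "(c, d) \<in> (adj_on S)\<^sup>* \<Longrightarrow> c \<in> S \<Longrightarrow> d \<in> S"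
  by (induction rule: rtrancl_induct) (auto simp: adj_on_def)

text \<open>By symmetry of adjacency every member represents its component, so components can be
  compared through a shared cell.\<close>

lemma cell_component_eq:
  assumes "\<theta> \<in> cell_components S" "c \<in> \<theta>"
  shows "c \<in> S" "\<theta> = (adj_on S)\<^sup>* `` {c}"
proof -
  obtain d where d: "d \<in> S" "\<theta> = (adj_on S)\<^sup>* `` {d}"
    using assms(1) by (auto simp: cell_components_def elim: quotientE)
  then have dc: "(d, c) \<in> (adj_on S)\<^sup>*" using assms(2) by simp
  then have "(c, d) \<in> (adj_on S)\<^sup>*" using sym_adj_on sym_rtrancl symD by metis
  with dc show "\<theta> = (adj_on S)\<^sup>* `` {c}" unfolding d(2) by (auto intro: rtrancl_trans)
  show "c \<in> S" using adj_on_rtrancl_mem[OF dc d(1)] .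
qed

lemma strip_component:
  assumes "\<theta> \<in> LP_strips lam mu"
  obtains e where "\<theta> \<in> cell_components (LP_layer lam mu e)"
  using assms by (auto simp: LP_strips_def)

lemma skew_cell_in_strip:
  assumes "skew_shape lam mu" "c \<in> skew lam mu"
  obtains \<theta> where "\<theta> \<in> LP_strips lam mu" "c \<in> \<theta>"
proof -
  obtain e where "c \<in> LP_layer lam mu e" using skew_cell_in_layer assms by (metis prod.collapse)
  then have "(adj_on (LP_layer lam mu e))\<^sup>* `` {c} \<in> LP_strips lam mu"
    by (auto simp: LP_strips_def cell_components_def intro: quotientI)
  then show ?thesis using that by blast
qed

text \<open>A common cell determines the layer, and within the layer the component.\<close>

lemma strips_disjoint:
  assumes "skew_shape lam mu" "\<theta> \<in> LP_strips lam mu" "\<theta>' \<in> LP_strips lam mu" "c \<in> \<theta>" "c \<in> \<theta>'"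
  shows "\<theta> = \<theta>'"
proof -
  obtain e e' where e: "\<theta> \<in> cell_components (LP_layer lam mu e)"
    and e': "\<theta>' \<in> cell_components (LP_layer lam mu e')"
    using assms(2,3) by (auto elim!: strip_component)
  have "e = e'"
    using layer_unique[OF assms(1)] cell_component_eq(1) e e' assms(4,5) by blast
  then show ?thesis
    using cell_component_eq(2)[OF e assms(4)] cell_component_eq(2)[OF e' assms(5)] by simp
qed

lemma strip_subset_skew: "\<theta> \<in> LP_strips lam mu \<Longrightarrow> \<theta> \<subseteq> skew lam mu"
  by (auto elim!: strip_component dest!: cell_component_eq(1) simp: LP_layer_def)

lemma strip_adjacent:
  assumes "\<theta> \<in> cell_components (LP_layer lam mu e)" "c \<in> \<theta>" "d \<in> LP_layer lam mu e"
    "\<bar>int (fst c) - int (fst d)\<bar> + \<bar>int (snd c) - int (snd d)\<bar> = 1"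
  shows "d \<in> \<theta>"
proof -
  have "(c, d) \<in> adj_on (LP_layer lam mu e)"
    using assms cell_component_eq(1)[OF assms(1,2)] by (auto simp: adj_on_def split: prod.splits)
  then show ?thesis using cell_component_eq(2)[OF assms(1,2)] by auto
qed

lemma strip_col_convex:
  assumes sk: "skew_shape lam mu" and th: "\<theta> \<in> LP_strips lam mu"
    and c: "(a, j) \<in> \<theta>" and d: "(b, j) \<in> \<theta>" and x: "a \<le> x" "x \<le> b"
  shows "(x, j) \<in> \<theta>"
proof -
  obtain e where e: "\<theta> \<in> cell_components (LP_layer lam mu e)" using th by (rule strip_component)
  have cL: "(a, j) \<in> LP_layer lam mu e" and dL: "(b, j) \<in> LP_layer lam mu e"
    using cell_component_eq(1)[OF e] c d by auto
  have aS: "(a, j) \<in> skew lam mu" "(a + e, j + e) \<in> skew lam mu"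
    and an: "(a + e + 1, j + e + 1) \<notin> diagram lam"
    and bS: "(b, j) \<in> diagram lam" "(b + e, j + e) \<in> diagram lam"
    using cL dL by (auto simp: LP_layer_def skew_def)
  have p: "is_partition lam" using sk by (simp add: skew_shape_def)
  \<comment> \<open>The whole segment lies in the layer: its shifts by \<open>e\<close> are trapped
    between those of the two ends, and its shifts by \<open>e + 1\<close> lie weakly below that of
    the upper end, which is already outside \<open>lam\<close>.\<close>
  have L: "(y, j) \<in> LP_layer lam mu e" if "a \<le> y" "y \<le> b" for y
  proof -
    have "(y, j) \<in> skew lam mu" using skew_convex[OF sk aS(1) bS(1)] that by simp
    moreover have "(y + e, j + e) \<in> skew lam mu" using skew_convex[OF sk aS(2) bS(2)] that by simp
    moreover have "(y + e + 1, j + e + 1) \<notin> diagram lam"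
      using diagram_downward_closed[OF p, of "y + e + 1" "j + e + 1" "a + e + 1" "j + e + 1"] an that
      by auto
    ultimately show ?thesis by (simp add: LP_layer_def)
  qed
  from x show ?thesis
  proof (induction x rule: dec_induct)
    case base
    show ?case using c .
  next
    case (step n)
    then show ?case using strip_adjacent[OF e, of "(n, j)" "(Suc n, j)"] L[of "Suc n"] by simp
  qed
qed

text \<open>Telescoping of condition (ii): the top entry determines a whole strip column, whose
  cells form a segment by convexity.\<close>

lemma strip_col_entries:
  fixes T :: "cell \<Rightarrow> int"
  assumes sk: "skew_shape lam mu" and th: "\<theta> \<in> LP_strips lam mu"
    and ii: "\<And>i. (i, j) \<in> \<theta> \<Longrightarrow> (i + 1, j) \<in> \<theta> \<Longrightarrow> T (i + 1, j) - T (i, j) = 1"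
    and c: "(a, j) \<in> \<theta>" "(b, j) \<in> \<theta>" and ab: "a \<le> b"
  shows "T (b, j) = T (a, j) + int (b - a)"
proof -
  have "x \<le> b \<longrightarrow> T (x, j) = T (a, j) + int (x - a)" if "a \<le> x" for x
    using that
  proof (induction x rule: dec_induct)
    case (step n)
    show ?case
    proof
      assume le: "Suc n \<le> b"
      have "(n, j) \<in> \<theta>" "(n + 1, j) \<in> \<theta>"
        using strip_col_convex[OF sk th c] step.hyps le by auto
      then have "T (n + 1, j) - T (n, j) = 1" by (rule ii)
      then show "T (Suc n, j) = T (a, j) + int (Suc n - a)" using step le by simp
    qed
  qed simp
  from this[OF ab] show ?thesis by blast
qed

text \<open>Justifies the \<open>THE\<close> in \<open>NE_cell\<close>. The witness is a cell of
  maximal content: no two cells of a layer are in strict south-east position, so a cell further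
  north or further east would have larger content. Uniqueness is antisymmetry.\<close>

lemma NE_cell_props:
  assumes sk: "skew_shape lam mu" and th: "\<theta> \<in> LP_strips lam mu" and ne: "c \<in> \<theta>"
  shows "NE_cell \<theta> \<in> \<theta>" "\<And>d. d \<in> \<theta> \<Longrightarrow> fst (NE_cell \<theta>) \<le> fst d \<and> snd d \<le> snd (NE_cell \<theta>)"
proof -
  let ?Q = "\<lambda>c. c \<in> \<theta> \<and> (\<forall>d\<in>\<theta>. fst c \<le> fst d \<and> snd d \<le> snd c)"
  obtain e where e: "\<theta> \<in> cell_components (LP_layer lam mu e)" using th by (rule strip_component)
  have fin: "finite \<theta>" using strip_subset_skew[OF th] finite_skew by (rule finite_subset)
  obtain m where m: "m \<in> \<theta>" "\<And>d. d \<in> \<theta> \<Longrightarrow> content d \<le> content m"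
    using obtains_MAX[of \<theta> content] Max_ge[of "content ` \<theta>"] fin ne
    by (metis empty_iff finite_imageI image_eqI)
  have "fst m \<le> fst d \<and> snd d \<le> snd m" if d: "d \<in> \<theta>" for d
  proof -
    have mL: "(fst m, snd m) \<in> LP_layer lam mu e" and dL: "(fst d, snd d) \<in> LP_layer lam mu e"
      using cell_component_eq(1)[OF e] m d by auto
    show ?thesis
      using m(2)[OF d] layer_no_strict_SE[OF sk mL dL] layer_no_strict_SE[OF sk dL mL]
      unfolding content_def by linarith
  qed
  then have Qm: "?Q m" using m(1) by blast
  have "?Q (NE_cell \<theta>)" unfolding NE_cell_def
  proof (rule theI[of ?Q, OF Qm])
    fix x assume "?Q x"
    then show "x = m" using Qm by (meson order_antisym prod.expand)
  qed
  then show "NE_cell \<theta> \<in> \<theta>" "\<And>d. d \<in> \<theta> \<Longrightarrow> fst (NE_cell \<theta>) \<le> fst d \<and> snd d \<le> snd (NE_cell \<theta>)"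
    by auto
qed

text \<open>Otherwise the cell above the north-east end lies in the skew shape, and the strip could be
  prolonged either to that cell or to the one on the right of its north-east end.\<close>

lemma first_row_le_column_top:
  assumes sk: "skew_shape lam mu" and th: "\<theta> \<in> LP_strips lam mu" and ij: "(i, j) \<in> \<theta>"
  shows "first_row \<theta> \<le> conj_part mu j + 1"
proof (rule ccontr)
  assume low: "\<not> ?thesis"
  obtain e where e: "\<theta> \<in> cell_components (LP_layer lam mu e)" using th by (rule strip_component)
  obtain f g where fg: "NE_cell \<theta> = (f, g)" by force
  have mem: "(f, g) \<in> \<theta>" and ext: "\<And>d. d \<in> \<theta> \<Longrightarrow> f \<le> fst d \<and> snd d \<le> g"
    using NE_cell_props[OF sk th ij] fg by auto
  have f: "f > conj_part mu j + 1" using low fg by (simp add: first_row_def)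
  have p: "is_partition lam" "is_partition mu" using sk by (auto simp: skew_shape_def)
  have j: "1 \<le> j" "j \<le> g" using ext[OF ij] strip_subset_skew[OF th] ij skew_pos by auto
  have L: "(f, g) \<in> LP_layer lam mu e" using cell_component_eq(1)[OF e mem] .
  then have S: "(f, g) \<in> skew lam mu" "(f + e, g + e) \<in> skew lam mu"
    "(f + e, g + e) \<in> diagram lam" "(f + e + 1, g + e + 1) \<notin> diagram lam"
    by (auto simp: LP_layer_def skew_def)
  have "(f - 1, g) \<in> diagram lam"
    using diagram_downward_closed[OF p(1), of f g] S(1) f j by (simp add: skew_def)
  \<comment> \<open>Column \<open>g\<close> is weakly right of \<open>j\<close>, so in it
    \<open>mu\<close> ends at or above row \<open>conj_part mu j\<close>, which is above row
    \<open>f - 1\<close>.\<close>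
  moreover have "(f - 1, g) \<notin> diagram mu"
    using diagram_conj_part[OF p(2), of g "f - 1"] conj_part_antimono[OF p(2) j] f j by auto
  ultimately have up: "(f - 1, g) \<in> skew lam mu" by (simp add: skew_def)
  show False
  \<comment> \<open>This cell decides the direction: if it is in \<open>lam\<close>, it is the shift
    by \<open>e\<close> of the right neighbour; if not, its absence is the outer condition for the
    upper neighbour to be in the layer.\<close>
  proof (cases "(f + e, g + e + 1) \<in> diagram lam")
    case True
    have "(f, g + 1) \<in> skew lam mu" using skew_convex[OF sk S(1) True] by simp
    moreover have "(f + e, g + 1 + e) \<in> skew lam mu" using skew_convex[OF sk S(1) True] by simp
    moreover have "(f + e + 1, g + 1 + e + 1) \<notin> diagram lam"
      using diagram_downward_closed[OF p(1), of "f + e + 1" "g + 1 + e + 1" "f + e + 1" "g + e + 1"] S(4)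
      by auto
    ultimately have "(f, g + 1) \<in> LP_layer lam mu e" by (simp add: LP_layer_def)
    then have "(f, g + 1) \<in> \<theta>" using strip_adjacent[OF e mem] by simp
    then show False using ext by fastforce
  next
    case False
    have "(f - 1 + e, g + e) \<in> skew lam mu" using skew_convex[OF sk up S(3)] by simp
    moreover have "(f - 1 + e + 1, g + e + 1) \<notin> diagram lam" using False f by simp
    ultimately have "(f - 1, g) \<in> LP_layer lam mu e" using up by (simp add: LP_layer_def)
    then have "(f - 1, g) \<in> \<theta>" using strip_adjacent[OF e mem] f by (simp add: of_nat_diff)
    then show False using ext f by fastforce
  qed
qed

section \<open>The two conditions\<close>

text \<open>This and the next definition are conditions (i) and (ii), quantified over the set of
  strips instead of positions in a list.\<close>

definition strip_bounded :: "nat list \<Rightarrow> nat list \<Rightarrow> (cell \<Rightarrow> int) \<Rightarrow> bool" where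
  "strip_bounded lam mu T \<longleftrightarrow>
    (\<forall>\<theta>\<in>LP_strips lam mu. \<forall>i j. (i, j) \<in> \<theta> \<longrightarrow> T (i, j) \<le> ht \<theta> i)"

definition strip_consecutive :: "nat list \<Rightarrow> nat list \<Rightarrow> (cell \<Rightarrow> int) \<Rightarrow> bool" where
  "strip_consecutive lam mu T \<longleftrightarrow>
    (\<forall>\<theta>\<in>LP_strips lam mu. \<forall>i j. (i, j) \<in> \<theta> \<and> (i + 1, j) \<in> \<theta> \<longrightarrow> T (i + 1, j) - T (i, j) = 1)"

lemma T0_eq: "(i, j) \<in> skew lam mu \<Longrightarrow> T0 lam mu (i, j) = int i - int (conj_part mu j) - 1"
  by (simp add: T0_def)

lemma T0_nonneg:
  assumes "skew_shape lam mu" "(i, j) \<in> skew lam mu"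
  shows "0 \<le> T0 lam mu (i, j)"
  using assms diagram_conj_part[of mu j i] skew_pos[OF assms(2)]
  by (auto simp: T0_eq skew_shape_def skew_def)

text \<open>After cancelling \<open>i\<close> the bound is exactly
  \<open>first_row_le_column_top\<close>.\<close>

lemma T0_strip_bounded:
  assumes "skew_shape lam mu"
  shows "strip_bounded lam mu (T0 lam mu)"
  unfolding strip_bounded_def
proof (intro ballI allI impI)
  fix \<theta> i j assume th: "\<theta> \<in> LP_strips lam mu" and ij: "(i, j) \<in> \<theta>"
  then have "(i, j) \<in> skew lam mu" using strip_subset_skew by blast
  then show "T0 lam mu (i, j) \<le> ht \<theta> i"
    using first_row_le_column_top[OF assms th ij] by (simp add: T0_eq ht_def)
qed

lemma T0_strip_consecutive: "strip_consecutive lam mu (T0 lam mu)"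
  unfolding strip_consecutive_def
proof (intro ballI allI impI)
  fix \<theta> i j assume "\<theta> \<in> LP_strips lam mu" "(i, j) \<in> \<theta> \<and> (i + 1, j) \<in> \<theta>"
  then have "(i, j) \<in> skew lam mu" "(i + 1, j) \<in> skew lam mu" using strip_subset_skew by blast+
  then show "T0 lam mu (i + 1, j) - T0 lam mu (i, j) = 1" using T0_eq by fastforce
qed

lemma strip_col_mem_iff:
  assumes "skew_shape lam mu" "\<theta> \<in> LP_strips lam mu" "\<theta>' \<in> LP_strips lam mu" "(i, j) \<in> \<theta>'"
  shows "(i, j) \<in> strip_col \<theta> k \<longleftrightarrow> \<theta> = \<theta>' \<and> j = k"
  using strips_disjoint[OF assms(1-3)] assms(4) by (auto simp: strip_col_def)

text \<open>Two vertically adjacent cells of one strip are raised together or not at all, so their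
  difference is invariant. The equivalence serves both performing a move and undoing it.\<close>

lemma strip_consecutive_move:
  assumes "skew_shape lam mu" "\<theta> \<in> LP_strips lam mu"
  shows "strip_consecutive lam mu (move \<theta> j T) \<longleftrightarrow> strip_consecutive lam mu T"
  unfolding strip_consecutive_def move_def
proof (intro ball_cong refl iff_allI imp_cong)
  fix \<theta>' a b assume th': "\<theta>' \<in> LP_strips lam mu" and ab: "(a, b) \<in> \<theta>' \<and> (a + 1, b) \<in> \<theta>'"
  show "((if (a + 1, b) \<in> strip_col \<theta> j then T (a + 1, b) + 1 else T (a + 1, b)) -
      (if (a, b) \<in> strip_col \<theta> j then T (a, b) + 1 else T (a, b)) = 1) \<longleftrightarrow>
      T (a + 1, b) - T (a, b) = 1"
    using strip_col_mem_iff[OF assms th', of a b j] strip_col_mem_iff[OF assms th', of "a + 1" b j] ab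
    by simp
qed

text \<open>Activity gives room below the bound only at the top of the strip column; going down,
  entries and heights both grow by 1 per row, so the room persists.\<close>

lemma strip_bounded_move:
  assumes sk: "skew_shape lam mu" and th: "\<theta> \<in> LP_strips lam mu" and act: "active lam mu T \<theta> j"
    and T: "strip_bounded lam mu T" "strip_consecutive lam mu T"
  shows "strip_bounded lam mu (move \<theta> j T)"
  unfolding strip_bounded_def
proof (intro ballI allI impI)
  fix \<theta>' a b assume th': "\<theta>' \<in> LP_strips lam mu" and ab: "(a, b) \<in> \<theta>'"
  show "move \<theta> j T (a, b) \<le> ht \<theta>' a"
  proof (cases "(a, b) \<in> strip_col \<theta> j")
    case True
    then have eq: "\<theta>' = \<theta>" "b = j" using strip_col_mem_iff[OF sk th th' ab] by auto
    define i where "i = Min (fst ` strip_col \<theta> j)"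
    have fin: "finite (fst ` strip_col \<theta> j)"
      using finite_subset[OF strip_subset_skew[OF th] finite_skew] by (simp add: strip_col_def)
    have "i \<in> fst ` strip_col \<theta> j" unfolding i_def by (rule Min_in[OF fin]) (use True in auto)
    then have i: "(i, j) \<in> \<theta>" by (auto simp: strip_col_def)
    have ia: "i \<le> a" unfolding i_def by (rule Min_le[OF fin]) (use True in force)
    have "T (a, j) = T (i, j) + int (a - i)"
      by (rule strip_col_entries[OF sk th _ i _ ia])
        (use T(2) th ab eq in \<open>auto simp: strip_consecutive_def\<close>)
    moreover have "T (i, j) < ht \<theta> i" using act by (simp add: active_def Let_def i_def)
    ultimately show ?thesis using True eq ia by (simp add: move_def ht_def)
  next
    case False
    then show ?thesis using T(1) th' ab by (simp add: move_def strip_bounded_def)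
  qed
qed

lemma SSYT_min_conditions:
  assumes "skew_shape lam mu" "T \<in> SSYT_min lam mu"
  shows "strip_bounded lam mu T \<and> strip_consecutive lam mu T"
  using assms(2)
proof induction
  case base
  show ?case using T0_strip_bounded T0_strip_consecutive assms(1) by blast
next
  case (step T \<theta> j)
  then show ?case using strip_consecutive_move strip_bounded_move assms(1) by blast
qed

section \<open>Descending to the minimal tableau\<close>

text \<open>Going down a column, entries of \<open>T\<close> grow by at least 1 per row, those of
  the minimal tableau by exactly 1; at the first cell of the column the latter is at most 0.\<close>

lemma T0_le_SSYT:
  assumes sk: "skew_shape lam mu" and T: "T \<in> SSYT lam mu" and ij: "(i, j) \<in> skew lam mu"
  shows "T0 lam mu (i, j) \<le> T (i, j)"
  using ij
proof (induction i)
  case 0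
  then show ?case using skew_pos by fastforce
next
  case (Suc i)
  have p: "is_partition lam" "is_partition mu" using sk by (auto simp: skew_shape_def)
  have j: "1 \<le> j" using skew_pos Suc.prems by blast
  show ?case
  proof (cases "(i, j) \<in> skew lam mu")
    case True
    then have "T (i, j) < T (Suc i, j)" using T Suc.prems by (auto simp: SSYT_def)
    then show ?thesis using Suc.IH[OF True] True Suc.prems by (simp add: T0_eq)
  next
    case False
    have "i \<le> conj_part mu j"
    proof (cases "i = 0")
      case i: False
      have "(i, j) \<in> diagram lam"
        using diagram_downward_closed[OF p(1), of "Suc i" j] Suc.prems i j by (simp add: skew_def)
      then have "(i, j) \<in> diagram mu" using False by (simp add: skew_def)
      then show ?thesis using diagram_conj_part[OF p(2) j] by simp
    qed simp
    then have "T0 lam mu (Suc i, j) \<le> 0" using T0_eq[OF Suc.prems] by simp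
    then show ?thesis using T Suc.prems by (fastforce simp: SSYT_def)
  qed
qed

lemma descent_step:
  assumes sk: "skew_shape lam mu" and T: "T \<in> SSYT lam mu"
    and bd: "strip_bounded lam mu T" and cs: "strip_consecutive lam mu T" and ne: "T \<noteq> T0 lam mu"
  obtains S \<theta> j where "S \<in> SSYT lam mu" "strip_bounded lam mu S" "strip_consecutive lam mu S"
    "\<theta> \<in> LP_strips lam mu" "active lam mu S \<theta> j" "T = move \<theta> j S"
proof -
  let ?D = "\<lambda>i j. (i, j) \<in> skew lam mu \<and> T0 lam mu (i, j) < T (i, j)"
  have p: "is_partition lam" "is_partition mu" using sk by (auto simp: skew_shape_def)
  have Text: "T \<in> extensional (skew lam mu)" using T by (simp add: SSYT_def)
  have ge: "T0 lam mu (a, b) \<le> T (a, b)" if "(a, b) \<in> skew lam mu" for a b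
    using T0_le_SSYT[OF sk T that] .
  have "\<exists>c\<in>skew lam mu. T c \<noteq> T0 lam mu c"
  proof (rule ccontr)
    assume "\<not> ?thesis"
    then have "T = T0 lam mu"
      by (intro extensionalityI[OF Text]) (auto simp: T0_def)
    with ne show False ..
  qed
  then have ex: "\<exists>j i. ?D i j" using ge by (metis order_le_neq_trans prod.collapse)
  define j where "j = (LEAST j. \<exists>i. ?D i j)"
  define i where "i = (LEAST i. ?D i j)"
  have exi: "\<exists>i. ?D i j" unfolding j_def using ex by (rule LeastI_ex)
  have ij: "?D i j" unfolding i_def using exi by (rule LeastI_ex)
  have left: "T (a, b) = T0 lam mu (a, b)" if "(a, b) \<in> skew lam mu" "b < j" for a b
    using not_less_Least[of b "\<lambda>j. \<exists>i. ?D i j"] that ge[of a b] unfolding j_def by force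
  have above: "T (a, j) = T0 lam mu (a, j)" if "(a, j) \<in> skew lam mu" "a < i" for a
    using not_less_Least[of a "\<lambda>i. ?D i j"] that ge[of a j] unfolding i_def by force
  obtain \<theta> where th: "\<theta> \<in> LP_strips lam mu" and ijth: "(i, j) \<in> \<theta>"
    using skew_cell_in_strip[OF sk] ij by blast
  have sub: "\<theta> \<subseteq> skew lam mu" using strip_subset_skew[OF th] .
  have consec: "T (b, j) = T (a, j) + int (b - a)" if "(a, j) \<in> \<theta>" "(b, j) \<in> \<theta>" "a \<le> b" for a b
    by (rule strip_col_entries[OF sk th _ that])
      (use cs th in \<open>auto simp: strip_consecutive_def\<close>)
  \<comment> \<open>A strip cell above row \<open>i\<close> would carry its minimal entry; since
    \<open>T\<close> and \<open>T0\<close> both grow by 1 per row here, the entry at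
    \<open>(i, j)\<close> would be minimal too.\<close>
  have top: "i \<le> a" if "(a, j) \<in> \<theta>" for a
  proof (rule ccontr)
    assume "\<not> i \<le> a"
    then have "T (i, j) = T (a, j) + int (i - a)" using consec[OF that ijth] by simp
    moreover have "(a, j) \<in> skew lam mu" using that sub by blast
    ultimately show False
      using above[of a] \<open>\<not> i \<le> a\<close> ij T0_eq[of i j lam mu] T0_eq[of a j lam mu]
      by (auto simp: of_nat_diff)
  qed
  \<comment> \<open>The excess over \<open>T0\<close> is constant along the strip column.\<close>
  have gt: "T0 lam mu (a, j) < T (a, j)" if "(a, j) \<in> \<theta>" for a
    using consec[OF ijth that top[OF that]] ij that sub top[OF that]
    by (auto simp: T0_eq of_nat_diff subset_iff)
  define S where "S = (\<lambda>c. if c \<in> strip_col \<theta> j then T c - 1 else T c)"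
  have TS: "T = move \<theta> j S" by (auto simp: move_def S_def)
  have S_le: "S c \<le> T c" for c by (simp add: S_def)
  have "S \<in> SSYT lam mu"
    unfolding SSYT_def mem_Collect_eq
  proof (intro conjI ballI allI impI)
    show "S \<in> extensional (skew lam mu)"
      using Text sub by (auto simp: extensional_def S_def strip_col_def)
  next
    fix c assume c: "c \<in> skew lam mu"
    obtain a b where ab: "c = (a, b)" by force
    have "0 \<le> T0 lam mu c" using T0_nonneg[OF sk] c ab by blast
    then show "0 \<le> S c" using gt[of a] ge[of a b] c ab by (auto simp: S_def strip_col_def)
  next
    fix a b b' assume h: "(a, b) \<in> skew lam mu \<and> (a, b') \<in> skew lam mu \<and> b < b'"
    show "S (a, b) \<le> S (a, b')"
    \<comment> \<open>Only lowering the right-hand cell is critical. Then the left cell is in a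
      column before \<open>j\<close>, hence minimal, \<open>T0\<close> increases weakly along rows,
      and the lowered entry is still at least \<open>T0\<close>.\<close>
    proof (cases "(a, b') \<in> strip_col \<theta> j")
      case True
      then have b': "b' = j" "(a, j) \<in> \<theta>" by (auto simp: strip_col_def)
      have "T (a, b) = T0 lam mu (a, b)" using left h b' by blast
      also have "\<dots> \<le> T0 lam mu (a, j)"
        using conj_part_antimono[OF p(2), of b j] skew_pos[of a b] h b' by (auto simp: T0_eq)
      also have "\<dots> \<le> S (a, b')" using gt[OF b'(2)] True b' by (simp add: S_def)
      finally show ?thesis using S_le[of "(a, b)"] by simp
    next
      case False
      have "T (a, b) \<le> T (a, b')" using T h unfolding SSYT_def by blast
      then show ?thesis using S_le[of "(a, b)"] False by (simp add: S_def)
    qed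
  next
    fix a a' b assume h: "(a, b) \<in> skew lam mu \<and> (a', b) \<in> skew lam mu \<and> a < a'"
    have lt: "T (a, b) < T (a', b)" using T h unfolding SSYT_def by blast
    show "S (a, b) < S (a', b)"
    \<comment> \<open>The critical case lowers the lower cell only; by convexity of the strip column
      the upper cell is then above row \<open>i\<close>, where \<open>T\<close> is minimal.\<close>
    proof (cases "(a', b) \<in> strip_col \<theta> j \<and> (a, b) \<notin> strip_col \<theta> j")
      case True
      then have b: "b = j" "(a', j) \<in> \<theta>" "(a, j) \<notin> \<theta>" by (auto simp: strip_col_def)
      have "a < i" using strip_col_convex[OF sk th ijth b(2), of a] b(3) h by force
      then have "T (a, j) = T0 lam mu (a, j)" using above h b by blast
      also have "\<dots> < T0 lam mu (a', j)" using h b by (auto simp: T0_eq)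
      also have "\<dots> \<le> T (a', j) - 1" using gt[OF b(2)] by simp
      finally show ?thesis using True b by (simp add: S_def)
    next
      case False
      then show ?thesis using lt by (auto simp: S_def)
    qed
  qed
  moreover have "strip_bounded lam mu S"
    using bd S_le unfolding strip_bounded_def by (meson order_trans)
  moreover have "strip_consecutive lam mu S"
    using cs strip_consecutive_move[OF sk th] unfolding TS by blast
  moreover have "active lam mu S \<theta> j"
  proof -
    let ?R = "fst ` strip_col \<theta> j"
    have fin: "finite ?R"
      using finite_subset[OF sub finite_skew] by (simp add: strip_col_def)
    have iR: "i \<in> ?R" using ijth by (force simp: strip_col_def)
    have mn: "Min ?R = i"
      by (rule Min_eqI[OF fin _ iR]) (use top in \<open>auto simp: strip_col_def\<close>)
    define m where "m = Max ?R"
    have "m \<in> ?R" unfolding m_def by (rule Max_in[OF fin]) (use iR in blast)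
    then have m: "(m, j) \<in> \<theta>" by (auto simp: strip_col_def)
    have "m + 1 \<notin> ?R" using Max_ge[OF fin, of "m + 1"] unfolding m_def by linarith
    then have m1: "(m + 1, j) \<notin> strip_col \<theta> j" by force
    have "S (i, j) < ht \<theta> i"
      using bd th ijth by (fastforce simp: strip_bounded_def S_def strip_col_def)
    \<comment> \<open>Neither the right neighbour nor the cell below the bottom \<open>m\<close> is
      lowered, so lowering the strip column yields the slack of 1 that activity demands.\<close>
    moreover have "S (i, j) < S (i, j + 1)" if "(i, j + 1) \<in> skew lam mu"
    proof -
      have "T (i, j) \<le> T (i, j + 1)" using T ij that by (auto simp: SSYT_def)
      then show ?thesis using ijth by (simp add: S_def strip_col_def)
    qed
    moreover have "S (m, j) < S (m + 1, j) - 1" if "(m + 1, j) \<in> skew lam mu"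
    proof -
      have "T (m, j) < T (m + 1, j)" using T m sub that by (auto simp: SSYT_def)
      then show ?thesis using m m1 by (simp add: S_def strip_col_def)
    qed
    ultimately show ?thesis
      using \<open>S \<in> SSYT lam mu\<close> iR by (auto simp: active_def Let_def mn m_def[symmetric])
  qed
  ultimately show ?thesis using that th TS by blast
qed

text \<open>Provides the measure for the descent: undoing a move strictly lowers the sum of the
  entries.\<close>

lemma sum_move_less:
  assumes "\<theta> \<in> LP_strips lam mu" "active lam mu S \<theta> j"
  shows "sum S (skew lam mu) < sum (move \<theta> j S) (skew lam mu)"
proof (rule sum_strict_mono_ex1[OF finite_skew])
  show "\<forall>c\<in>skew lam mu. S c \<le> move \<theta> j S c" by (simp add: move_def)
  obtain c where "c \<in> strip_col \<theta> j" using assms(2) by (auto simp: active_def)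
  then show "\<exists>c\<in>skew lam mu. S c < move \<theta> j S c"
    using strip_subset_skew[OF assms(1)] by (intro bexI[of _ c]) (auto simp: move_def strip_col_def)
qed

lemma conditions_SSYT_min:
  assumes sk: "skew_shape lam mu"
    and "T \<in> SSYT lam mu" "strip_bounded lam mu T" "strip_consecutive lam mu T"
  shows "T \<in> SSYT_min lam mu"
  using assms(2-)
proof (induction "nat (sum T (skew lam mu))" arbitrary: T rule: less_induct)
  case less
  show ?case
  proof (cases "T = T0 lam mu")
    case True
    then show ?thesis using SSYT_min.base by simp
  next
    case False
    obtain S \<theta> j where S: "S \<in> SSYT lam mu" "strip_bounded lam mu S" "strip_consecutive lam mu S"
      "\<theta> \<in> LP_strips lam mu" "active lam mu S \<theta> j" "T = move \<theta> j S"
      using descent_step[OF sk less.prems False] .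
    \<comment> \<open>As \<open>nat\<close> truncates at 0, nonnegativity is what carries the strict
      decrease over to natural numbers.\<close>
    have "0 \<le> sum S (skew lam mu)" using S(1) by (intro sum_nonneg) (auto simp: SSYT_def)
    then have "nat (sum S (skew lam mu)) < nat (sum T (skew lam mu))"
      using sum_move_less[OF S(4,5)] S(6) by simp
    then have "S \<in> SSYT_min lam mu" using less.hyps S(1-3) by blast
    then show ?thesis using SSYT_min.step S(4-6) by blast
  qed
qed

theorem theorem3p9:
  fixes lam mu :: "nat list" and \<theta>s :: "cell set list" and T :: "cell \<Rightarrow> int"
  assumes "skew_shape lam mu"
    and "connected_cells (skew lam mu)"
    and "LP_decomposition lam mu \<theta>s"
    and "T \<in> SSYT lam mu"
  shows "T \<in> SSYT_min lam mu \<longleftrightarrow>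
    (\<forall>r<length \<theta>s. \<forall>i j. (i, j) \<in> \<theta>s ! r \<longrightarrow> T (i, j) \<le> ht (\<theta>s ! r) i) \<and>
    (\<forall>r<length \<theta>s. \<forall>i j. (i, j) \<in> \<theta>s ! r \<and> (i + 1, j) \<in> \<theta>s ! r \<longrightarrow> T (i + 1, j) - T (i, j) = 1)"
proof -
  \<comment> \<open>Positions in the list run through exactly the strips, which translates the two
    conditions.\<close>
  have "set \<theta>s = LP_strips lam mu" using assms(3) by (simp add: LP_decomposition_def)
  then have "strip_bounded lam mu T \<longleftrightarrow>
      (\<forall>r<length \<theta>s. \<forall>i j. (i, j) \<in> \<theta>s ! r \<longrightarrow> T (i, j) \<le> ht (\<theta>s ! r) i)"
    and "strip_consecutive lam mu T \<longleftrightarrow>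
      (\<forall>r<length \<theta>s. \<forall>i j. (i, j) \<in> \<theta>s ! r \<and> (i + 1, j) \<in> \<theta>s ! r \<longrightarrow> T (i + 1, j) - T (i, j) = 1)"
    unfolding strip_bounded_def strip_consecutive_def by (metis in_set_conv_nth)+
  then show ?thesis
    using SSYT_min_conditions conditions_SSYT_min assms(1,4) by blast
qed

end
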